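(* Let $\mu = 1$ if $\mathrm{rank}(G(0)) = m = n$, $\mu = \sqrt{2}$ if $\mathrm{rank}(G(0)) = \min(m,n)$ and $m \neq n$, and $\mu = \frac{1 + \sqrt{5}}{2}$ if $\mathrm{rank}(G(0)) < \min(m,n)$. Let $x\in\mathbb{R}^n$ satisfy $(L_f + L_G)\|x\| \leq \|G(0)^{\dagger}\|^{-1}$. If $$\bar{\bar{\mathcal{V}}}^{\mathcal{G}}_x = \{f(0) + kd \mid \|d\| = 1,\ d\in \mathrm{Im}(R),\ 0 \leq k \leq K(d)\},$$ where $$K(d) = \frac{\|G(0)^\dagger\|^{-1} - L_G\|x\| - L_f\|x\|}{\|G(0)^\dagger d\|\,(\|G(0)^\dagger\|^{-1} - L_G\|x\|) + \mu\|G(0)^\dagger\| L_G\|x\|},$$ then $\bar{\bar{\mathcal{V}}}^{\mathcal{G}}_x \subseteq \mathcal{V}^{\mathcal{G}}_x$.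
   Context: Notation: $\|v\|$ is the Euclidean norm of a vector $v$; $\|M\|=\max_{\|v\|=1}\|Mv\|$ for a matrix $M$; $M^\dagger$ is the Moore-Penrose pseudoinverse; $\mathrm{Im}(M)$ is the range of $M$; $\mathbb{B}^n(a;b)$ is the closed Euclidean ball in $\mathbb{R}^n$ with center $a$ and radius $b\ge 0$; for $\mathcal{X}\subseteq\mathbb{R}^m$, $a+B\mathcal{X}=\{a+Bv \mid v\in\mathcal{X}\}$. A function $h$ has Lipschitz constant $L$ if $\|h(x)-h(y)\|\le L\|x-y\|$ for all $x,y\in\mathbb{R}^n$. Setting: $L_f>0$ and $L_G>0$ are given; $f:\mathbb{R}^n\to\mathbb{R}^n$ is Lipschitz with constant $L_f$ and $G:\mathbb{R}^n\to\mathbb{R}^{n\times m}$ is Lipschitz with constant $L_G$ (with respect to the matrix norm $\|M\|=\max_{\|v\|=1}\|Mv\|$); $\mathcal{U}=\mathbb{B}^m(0;1)$. There exist $R\in\mathbb{R}^{n\times m}$ and functions $r:\mathbb{R}^n\to\mathbb{R}^m$, $H:\mathbb{R}^n\to\mathbb{R}^{m\times m}$ with $f(x)=Rr(x)$ and $G(x)=RH(x)$ for all $x$, and $H(0)$ invertible (Assumption 1); $R$ in the claim is this matrix (so $\mathrm{Im}(R)=\mathrm{Im}(G(0))$). The values $f(0)$, $G(0)$ and the bounds $L_f,L_G$ are known, and $G(0)\neq 0$ (Assumption 2). Consistent systems: $\mathcal{D}_{con}$ is the set of all pairs $(\hat f,\hat G)$ such that $\hat f:\mathbb{R}^n\to\mathbb{R}^n$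 is Lipschitz with constant $L_f$, $\hat G:\mathbb{R}^n\to\mathbb{R}^{n\times m}$ is Lipschitz with constant $L_G$, $\hat f(0)=f(0)$, $\hat G(0)=G(0)$, and there exist $R'\in\mathbb{R}^{n\times m}$, $r':\mathbb{R}^n\to\mathbb{R}^m$, $H':\mathbb{R}^n\to\mathbb{R}^{m\times m}$ with $\hat f=R'r'$, $\hat G=R'H'$ and $H'(0)$ invertible. Guaranteed velocity set at $x\in\mathbb{R}^n$: $\mathcal{V}^{\mathcal{G}}_x=\bigcap_{(\hat f,\hat G)\in\mathcal{D}_{con}}\big(\hat f(x)+\hat G(x)\mathcal{U}\big)$. *)

theory Defs
  imports "HOL-Analysis.Analysis"
begin

text \<open>The type-class norm on \<open>real^'m^'n\<close> is the Frobenius norm, so the spectral norm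
  is introduced separately; \<open>matrix_norm_is_max\<close> identifies it with the maximum
  of \<open>norm (M *v v)\<close> over unit vectors.\<close>

definition matrix_norm :: "real^'m^'n \<Rightarrow> real" where
  "matrix_norm M = onorm ((*v) M)"

lemma matrix_norm_is_max:
  fixes M :: "real^'m^'n"
  shows "\<exists>v. norm v = 1 \<and> norm (M *v v) = matrix_norm M"
    and "norm v = 1 \<Longrightarrow> norm (M *v v) \<le> matrix_norm M"
proof -
  have bl: "bounded_linear ((*v) M)"
    by (rule matrix_vector_mul_bounded_linear)
  show le: "norm (M *v v) \<le> matrix_norm M" if "norm v = 1" for v
    using onorm[OF bl, of v] that by (simp add: matrix_norm_def)
  have "continuous_on (sphere 0 1) (\<lambda>v. norm (M *v v))"
    by (intro continuous_on_norm linear_continuous_on bl)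
  then obtain v where v: "v \<in> sphere 0 1"
      "\<And>w. w \<in> sphere 0 1 \<Longrightarrow> norm (M *v w) \<le> norm (M *v v)"
    using continuous_attains_sup[of "sphere (0::real^'m) 1" "\<lambda>v. norm (M *v v)"] by auto
  have "norm (M *v w) \<le> norm (M *v v) * norm w" for w
  proof (cases "w = 0")
    case False
    then have "norm (M *v ((1 / norm w) *\<^sub>R w)) \<le> norm (M *v v)"
      by (intro v(2)) simp
    with False show ?thesis
      by (simp add: matrix_vector_mult_scaleR field_simps)
  qed simp
  then have "matrix_norm M \<le> norm (M *v v)"
    unfolding matrix_norm_def by (intro onorm_bound) auto
  with v(1) le[of v] show "\<exists>v. norm v = 1 \<and> norm (M *v v) = matrix_norm M"
    by (intro exI[of _ v]) auto
qed

definition moore_penrose :: "real^'m^'n \<Rightarrow> real^'n^'m \<Rightarrow> bool" where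
  "moore_penrose A X \<longleftrightarrow>
     A ** X ** A = A \<and> X ** A ** X = X \<and>
     transpose (A ** X) = A ** X \<and> transpose (X ** A) = X ** A"

definition pinv :: "real^'m^'n \<Rightarrow> real^'n^'m" where
  "pinv A = (THE X. moore_penrose A X)"

lemma moore_penrose_unique:
  assumes "moore_penrose A X" "moore_penrose A Y"
  shows "X = Y"
proof -
  note a = assms[unfolded moore_penrose_def]
  have "X = X ** (A ** Y ** A) ** X"
    using a by (simp add: matrix_mul_assoc)
  also have "\<dots> = X ** transpose (A ** Y ** (A ** X))"
  proof -
    have "transpose (A ** Y ** (A ** X)) = transpose (A ** X) ** transpose (A ** Y)"
      by (rule matrix_transpose_mul)
    also have "\<dots> = A ** X ** A ** Y"
      using a by (simp add: matrix_mul_assoc)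
    also have "\<dots> = A ** Y"
      using a by simp
    also have "\<dots> = transpose (A ** Y)"
      using a by simp
    also have "\<dots> = transpose (A ** X ** (A ** Y))"
      using a by (simp add: matrix_mul_assoc)
    also have "\<dots> = transpose (A ** Y) ** transpose (A ** X)"
      by (rule matrix_transpose_mul)
    also have "\<dots> = A ** Y ** (A ** X)"
      using a by simp
    finally show ?thesis
      by (simp add: matrix_mul_assoc)
  qed
  also have "\<dots> = X ** (A ** Y)"
  proof -
    have "transpose (A ** Y ** (A ** X)) = transpose (A ** X) ** transpose (A ** Y)"
      by (rule matrix_transpose_mul)
    also have "\<dots> = A ** Y"
      using a by (simp add: matrix_mul_assoc)
    finally show ?thesis by simp
  qed
  finally have 1: "X = X ** A ** Y" by (simp add: matrix_mul_assoc)
  have "Y = Y ** A ** Y" using a by simp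
  also have "Y ** A = X ** A"
  proof -
    have "Y ** A = transpose (Y ** A)" using a by simp
    also have "\<dots> = transpose (Y ** A ** (X ** A))"
      using a by (metis matrix_mul_assoc)
    also have "\<dots> = transpose (X ** A) ** transpose (Y ** A)"
      by (rule matrix_transpose_mul)
    also have "\<dots> = X ** A ** (Y ** A)"
      using a by simp
    also have "\<dots> = X ** A"
      using a by (metis matrix_mul_assoc)
    finally show ?thesis .
  qed
  finally have "Y = X ** A ** Y" .
  with 1 show ?thesis by simp
qed

lemma inner_transpose:
  fixes A :: "real^'m^'n"
  shows "(A *v x) \<bullet> y = x \<bullet> (transpose A *v y)"
  by (metis dot_lmul_matrix inner_commute transpose_matrix_vector)

lemma symmetric_matrixI:
  fixes M :: "real^'n^'n"
  assumes "\<And>x y. (M *v x) \<bullet> y = x \<bullet> (M *v y)"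
  shows "transpose M = M"
proof -
  have "transpose M *v y = M *v y" for y
  proof -
    have "x \<bullet> (transpose M *v y) = x \<bullet> (M *v y)" for x
      using assms[of x y] by (simp add: inner_transpose)
    then show ?thesis by (metis vector_eq_ldot)
  qed
  then show ?thesis by (simp add: matrix_eq)
qed

lemma moore_penrose_exists:
  fixes A :: "real^'m^'n"
  shows "\<exists>X. moore_penrose A X"
proof -
  note transpose_matrix_vector [simp del]
  let ?T = "transpose A"
  let ?S = "range ((*v) ?T)"
  have subS: "subspace ?S"
    by (intro linear_subspace_image matrix_vector_mul_linear subspace_UNIV)
  have decomp: "\<exists>y z. x = A *v y + z \<and> ?T *v z = 0" for x
  proof -
    have "subspace (range ((*v) A))"
      by (intro linear_subspace_image matrix_vector_mul_linear subspace_UNIV)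
    then have sp: "span (range ((*v) A)) = range ((*v) A)" by simp
    obtain y z where yz: "y \<in> range ((*v) A)" "\<And>w. w \<in> range ((*v) A) \<Longrightarrow> orthogonal z w"
        "x = y + z"
      using orthogonal_subspace_decomp_exists[of "range ((*v) A)" x, unfolded sp] by blast
    have "w \<bullet> (?T *v z) = 0" for w
      using yz(2)[of "A *v w"] by (simp add: inner_transpose[symmetric] orthogonal_def inner_commute)
    then have "?T *v z = 0" by (metis inner_eq_zero_iff)
    with yz show ?thesis by auto
  qed
  have decompS: "\<exists>y z. x = y + z \<and> y \<in> ?S \<and> A *v z = 0" for x
  proof -
    have sp: "span ?S = ?S" using subS by simp
    obtain y z where yz: "y \<in> ?S" "\<And>w. w \<in> ?S \<Longrightarrow> orthogonal z w" "x = y + z"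
      using orthogonal_subspace_decomp_exists[of "?S" x, unfolded sp] by blast
    have "(A *v z) \<bullet> w = 0" for w
      using yz(2)[of "?T *v w"] by (simp add: inner_transpose orthogonal_def)
    then have "A *v z = 0" by (metis inner_eq_zero_iff)
    with yz show ?thesis by auto
  qed
  have ker: "A *v x = 0" if "?T *v (A *v x) = 0" for x
    using that by (metis inner_eq_zero_iff inner_transpose inner_zero_right)
  have inj: "x = 0" if x: "x \<in> ?S" "A *v x = 0" for x
  proof -
    obtain w where w: "x = ?T *v w" using x(1) by blast
    have "x \<bullet> x = (A *v x) \<bullet> w" by (simp add: w inner_transpose)
    then show ?thesis using x(2) by simp
  qed
  have ex: "\<exists>x. x \<in> ?S \<and> ?T *v (A *v x) = ?T *v y" for y
  proof -
    obtain u z where u: "y = A *v u + z" "?T *v z = 0" using decomp by blast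
    obtain a b where a: "u = a + b" "a \<in> ?S" "A *v b = 0" using decompS by blast
    have "?T *v (A *v a) = ?T *v y"
      using u a by (simp add: matrix_vector_right_distrib)
    with a show ?thesis by blast
  qed
  then obtain g where g: "\<And>y. g y \<in> ?S" "\<And>y. ?T *v (A *v g y) = ?T *v y" by metis
  have uniq: "x = g y" if "x \<in> ?S" "?T *v (A *v x) = ?T *v y" for x y
  proof -
    have "x - g y \<in> ?S" using subspace_diff[OF subS that(1) g(1)] .
    moreover have "?T *v (A *v (x - g y)) = 0"
      using that(2) g(2) by (simp add: matrix_vector_mult_diff_distrib)
    ultimately have "x - g y = 0" using ker inj by blast
    then show ?thesis by simp
  qed
  have lin: "linear g"
  proof (rule linearI)
    fix x y :: "real^'n" and c :: real
    show "g (x + y) = g x + g y"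
      by (rule uniq[symmetric])
        (use g subspace_add[OF subS] in \<open>simp_all add: matrix_vector_right_distrib\<close>)
    show "g (c *\<^sub>R x) = c *\<^sub>R g x"
      by (rule uniq[symmetric])
        (use g subspace_scale[OF subS] in \<open>simp_all add: matrix_vector_mult_scaleR\<close>)
  qed
  define X where "X = matrix g"
  have X: "X *v y = g y" for y
    unfolding X_def by (rule matrix_works) (use lin in \<open>simp add: linear_matrix_vector_mul_eq\<close>)
  have AgA: "A *v g (A *v x) = A *v x" for x
    using ker[of "g (A *v x) - x"] g(2)[of "A *v x"]
    by (simp add: matrix_vector_mult_diff_distrib)
  have gAg: "g (A *v g y) = g y" for y
    by (rule uniq[symmetric]) (use g in auto)
  have P: "(A *v g x) \<bullet> y = (A *v g x) \<bullet> (A *v g y)" for x y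
    by (simp add: inner_transpose g(2))
  have Q: "g (A *v x) \<bullet> y = g (A *v x) \<bullet> g (A *v y)" for x y
  proof -
    obtain w where w: "g (A *v x) = ?T *v w" using g(1)[of "A *v x"] by blast
    have "(?T *v w) \<bullet> v = w \<bullet> (A *v v)" for v
      by (simp add: inner_transpose)
    then show ?thesis unfolding w by (simp add: AgA)
  qed
  have "moore_penrose A X"
    unfolding moore_penrose_def
  proof (intro conjI)
    show "A ** X ** A = A"
      by (simp add: matrix_eq X AgA flip: matrix_vector_mul_assoc)
    show "X ** A ** X = X"
      by (simp add: matrix_eq X gAg flip: matrix_vector_mul_assoc)
    show "transpose (A ** X) = A ** X"
      by (rule symmetric_matrixI)
        (simp add: X flip: matrix_vector_mul_assoc, metis P inner_commute)
    show "transpose (X ** A) = X ** A"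
      by (rule symmetric_matrixI)
        (simp add: X flip: matrix_vector_mul_assoc, metis Q inner_commute)
  qed
  then show ?thesis by blast
qed

lemma moore_penrose_pinv: "moore_penrose A (pinv A)"
  unfolding pinv_def using moore_penrose_exists moore_penrose_unique by (metis theI)

definition matrix_lipschitz :: "real \<Rightarrow> ('a::real_normed_vector \<Rightarrow> real^'m^'n) \<Rightarrow> bool" where
  "matrix_lipschitz L G \<longleftrightarrow> (\<forall>x y. matrix_norm (G x - G y) \<le> L * norm (x - y))"

definition factors_through ::
  "real^'m^'n \<Rightarrow> (real^'n \<Rightarrow> real^'m) \<Rightarrow> (real^'n \<Rightarrow> real^'m^'m) \<Rightarrow>
   (real^'n \<Rightarrow> real^'n) \<Rightarrow> (real^'n \<Rightarrow> real^'m^'n) \<Rightarrow> bool" where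
  "factors_through R r H f G \<longleftrightarrow>
     (\<forall>x. f x = R *v r x) \<and> (\<forall>x. G x = R ** H x) \<and> invertible (H 0)"

definition consistent_systems ::
  "real \<Rightarrow> real \<Rightarrow> (real^'n \<Rightarrow> real^'n) \<Rightarrow> (real^'n \<Rightarrow> real^'m^'n) \<Rightarrow>
   ((real^'n \<Rightarrow> real^'n) \<times> (real^'n \<Rightarrow> real^'m^'n)) set" where
  "consistent_systems L\<^sub>f L\<^sub>G f G =
     {(f', G'). L\<^sub>f-lipschitz_on UNIV f' \<and> matrix_lipschitz L\<^sub>G G' \<and>
        f' 0 = f 0 \<and> G' 0 = G 0 \<and> (\<exists>R r H. factors_through R r H f' G')}"

definition guaranteed_velocity_set ::
  "real \<Rightarrow> real \<Rightarrow> (real^'n \<Rightarrow> real^'n) \<Rightarrow> (real^'n \<Rightarrow> real^'m^'n) \<Rightarrow> real^'n \<Rightarrow> (real^'n) set" where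
  "guaranteed_velocity_set L\<^sub>f L\<^sub>G f G x =
     (\<Inter>(f', G') \<in> consistent_systems L\<^sub>f L\<^sub>G f G. {f' x + G' x *v u | u. u \<in> cball 0 1})"

definition speed_bound ::
  "real \<Rightarrow> real \<Rightarrow> real \<Rightarrow> real^'m^'n \<Rightarrow> real^'n \<Rightarrow> real^'n \<Rightarrow> real" where
  "speed_bound L\<^sub>f L\<^sub>G \<mu> G\<^sub>0 x d =
     (inverse (matrix_norm (pinv G\<^sub>0)) - L\<^sub>G * norm x - L\<^sub>f * norm x) /
     (norm (pinv G\<^sub>0 *v d) * (inverse (matrix_norm (pinv G\<^sub>0)) - L\<^sub>G * norm x)
        + \<mu> * matrix_norm (pinv G\<^sub>0) * L\<^sub>G * norm x)"

end

theory Submission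
  imports Defs
begin

text \<open>Write \<open>A = G 0\<close>, \<open>X = pinv A\<close>, \<open>a = matrix_norm X\<close>, and let \<open>(f', G')\<close> be a
  consistent system. A velocity \<open>f 0 + k *\<^sub>R d\<close> is attained by that system at \<open>x\<close> exactly if
  \<open>G' x *v u = y\<close> has a solution in the unit ball, where \<open>y = (f 0 - f' x) + k *\<^sub>R d\<close>.
  The factorisation of the system, with an invertible factor at the origin, puts \<open>f 0\<close>, \<open>f' x\<close>
  and every column of \<open>G' x\<close> into the range of \<open>A\<close>; the direction \<open>d\<close> lies there as well. So
  everything happens inside one fixed subspace, on which \<open>A\<close> has the right inverse \<open>X\<close>.

  Put \<open>E = G' x - A\<close>, of norm at most \<open>g = L\<^sub>G * norm x\<close>. On the range of \<open>A\<close> the map \<open>G' x ** X\<close> is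
  the identity plus \<open>E ** X\<close>, a perturbation of norm \<open>< 1\<close>, hence bijective there. This gives a
  solution \<open>u\<close> in the range of \<open>X\<close>, and \<open>u = X *v (y - E *v u)\<close>; taking norms,
  \<open>(1 - a * g) * norm u \<le> norm (X *v y)\<close> (\<open>perturbed_preimage\<close>). The right-hand side is at most
  \<open>a * L\<^sub>f * norm x + k * norm (X *v d)\<close>. Since \<open>norm (X *v d) \<le> a\<close> and each of the three values
  of \<open>\<mu>\<close> is at least 1, the bound on \<open>k\<close> makes this at most \<open>1 - a * g\<close>
  (\<open>speed_bound_arith\<close>), so \<open>norm u \<le> 1\<close>.\<close>

lemma norm_matrix_vector_le: "norm (M *v v) \<le> matrix_norm M * norm v"
  unfolding matrix_norm_def by (rule onorm[OF matrix_vector_mul_bounded_linear])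

lemma matrix_norm_nonneg: "0 \<le> matrix_norm M"
  unfolding matrix_norm_def by (rule onorm_pos_le[OF matrix_vector_mul_bounded_linear])

lemma matrix_norm_pos:
  assumes "M \<noteq> 0"
  shows "0 < matrix_norm M"
proof -
  obtain v where v: "M *v v \<noteq> 0"
    using assms by (metis matrix_eq matrix_vector_mult_0)
  have "matrix_norm M \<noteq> 0"
    using v norm_matrix_vector_le[of M v] by auto
  then show ?thesis
    using matrix_norm_nonneg[of M] by linarith
qed

lemma subspace_range_matrix: "subspace (range ((*v) (M :: real^'m^'n)))"
  by (intro linear_subspace_image matrix_vector_mul_linear subspace_UNIV)

text \<open>Invertibility of \<open>H 0\<close> makes \<open>R\<close> and \<open>G 0 = R ** H 0\<close> have the same range, so a
  constraint on the unknown factor \<open>R\<close> becomes one on the known matrix \<open>G 0\<close>.\<close>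

lemma factors_through_ranges:
  assumes "factors_through R r H f G"
  shows "range ((*v) R) = range ((*v) (G 0))"
    and "f x \<in> range ((*v) (G 0))"
    and "range ((*v) (G x)) \<subseteq> range ((*v) (G 0))"
proof -
  note F = assms[unfolded factors_through_def]
  have G: "G z *v u = R *v (H z *v u)" for z u
    using F by (simp add: matrix_vector_mul_assoc)
  obtain H' where H': "H 0 ** H' = mat 1"
    using F invertible_def by blast
  have "R *v w = G 0 *v (H' *v w)" for w
    by (metis G H' matrix_vector_mul_assoc matrix_vector_mul_lid)
  then show R: "range ((*v) R) = range ((*v) (G 0))"
    using G by auto
  show "f x \<in> range ((*v) (G 0))"
    unfolding R[symmetric] using F by auto
  show "range ((*v) (G x)) \<subseteq> range ((*v) (G 0))"
    unfolding R[symmetric] using G by auto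
qed

lemma linear_inj_endo_surj_on_subspace:
  fixes T :: "'a::euclidean_space \<Rightarrow> 'a"
  assumes "linear T" "subspace S" "T ` S \<subseteq> S"
    and "\<And>z. z \<in> S \<Longrightarrow> T z = 0 \<Longrightarrow> z = 0"
  shows "T ` S = S"
proof (rule subspace_dim_equal)
  show "subspace (T ` S)"
    by (rule linear_subspace_image[OF assms(1,2)])
  have "inj_on T S"
    using linear_inj_on_iff_eq_0[OF assms(1,2)] assms(4) by blast
  then have "dim (T ` S) = dim S"
    using assms(1,2) by (intro dim_image_eq) (simp_all add: span_eq_iff[THEN iffD2])
  then show "dim S \<le> dim (T ` S)"
    by simp
qed (use assms in auto)

text \<open>The identity \<open>A ** X ** A = A\<close> makes \<open>X\<close> a right inverse of \<open>A\<close> on the range of \<open>A\<close>.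
  Because the perturbed matrix \<open>B\<close> maps into that range too, \<open>B ** X\<close> acts on it as an
  endomorphism close to the identity, injective because \<open>matrix_norm X * e < 1\<close> and so
  surjective. If \<open>z\<close> is the preimage of \<open>y\<close>, then \<open>u = X *v z\<close> solves \<open>B *v u = y\<close>, and
  \<open>z = y - (B - A) *v u\<close>. Comparing with \<open>X *v y\<close> instead of \<open>y\<close> keeps the dependence on the
  direction of \<open>y\<close>.\<close>

lemma perturbed_preimage:
  fixes A B :: "real^'m^'n" and X :: "real^'n^'m"
  assumes AXA: "A ** X ** A = A"
    and range_B: "range ((*v) B) \<subseteq> range ((*v) A)"
    and e: "matrix_norm (B - A) \<le> e"
    and small: "matrix_norm X * e < 1"
    and y: "y \<in> range ((*v) A)"
  shows "\<exists>u. B *v u = y \<and> (1 - matrix_norm X * e) * norm u \<le> norm (X *v y)"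
proof -
  let ?a = "matrix_norm X" and ?E = "B - A" and ?S = "range ((*v) A)"
  let ?T = "\<lambda>z. B *v (X *v z)"
  have AX: "A *v (X *v z) = z" if "z \<in> ?S" for z
    using that AXA by (auto simp: matrix_vector_mul_assoc)
  have T: "?T z = z + ?E *v (X *v z)" if "z \<in> ?S" for z
    using AX[OF that] by (simp add: matrix_vector_mult_diff_rdistrib)
  have XE: "norm (X *v (?E *v w)) \<le> ?a * e * norm w" for w
  proof -
    have "norm (X *v (?E *v w)) \<le> ?a * norm (?E *v w)"
      by (rule norm_matrix_vector_le)
    also have "\<dots> \<le> ?a * (e * norm w)"
      using norm_matrix_vector_le[of ?E w] mult_right_mono[OF e norm_ge_zero[of w]]
      by (intro mult_left_mono matrix_norm_nonneg) linarith
    finally show ?thesis by (simp add: mult.assoc)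
  qed
  have "?T ` ?S = ?S"
  proof (rule linear_inj_endo_surj_on_subspace)
    show "linear ?T"
      using matrix_vector_mul_linear[of "B ** X"] by (simp add: matrix_vector_mul_assoc)
    show "?T ` ?S \<subseteq> ?S"
      using range_B by auto
    fix z assume z: "z \<in> ?S" "?T z = 0"
    have "X *v z + X *v (?E *v (X *v z)) = X *v (?T z)"
      using T[OF z(1)] by (simp add: matrix_vector_right_distrib)
    then have "X *v z = - (X *v (?E *v (X *v z)))"
      using z(2) by (simp add: eq_neg_iff_add_eq_0)
    then have "norm (X *v z) \<le> ?a * e * norm (X *v z)"
      using XE[of "X *v z"] by (metis norm_minus_cancel)
    then have "(1 - ?a * e) * norm (X *v z) \<le> 0"
      by (simp add: algebra_simps)
    then have "X *v z = 0"
      using small by (simp add: mult_le_0_iff)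
    then show "z = 0"
      using AX[OF z(1)] by simp
  qed (rule subspace_range_matrix)
  then obtain z where z: "z \<in> ?S" "?T z = y"
    using y by (metis imageE)
  let ?u = "X *v z"
  have "X *v y = ?u + X *v (?E *v ?u)"
    using T[OF z(1)] z(2) by (metis matrix_vector_right_distrib)
  then have "norm ?u \<le> norm (X *v y) + norm (X *v (?E *v ?u))"
    by (metis add_diff_cancel_right' norm_triangle_ineq4)
  then have "(1 - ?a * e) * norm ?u \<le> norm (X *v y)"
    using XE[of ?u] by (simp add: algebra_simps)
  with z(2) show ?thesis by blast
qed

text \<open>Here \<open>a\<close> is the norm of the pseudoinverse, \<open>q\<close> the norm of its value at the unit
  direction, and \<open>g\<close>, \<open>p\<close> bound the deviations of the input matrix and the drift. The term
  \<open>\<mu> * a * g\<close> in the denominator absorbs the difference \<open>q * g\<close> between \<open>q * inverse a\<close> and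
  \<open>q * (inverse a - g)\<close>.\<close>

lemma speed_bound_arith:
  fixes a q g p k \<mu> :: real
  assumes a: "0 < a" and q: "0 < q" "q \<le> a" and g: "0 \<le> g" "g < inverse a"
    and \<mu>: "1 \<le> \<mu>" and k: "0 \<le> k"
    and le: "k \<le> (inverse a - g - p) / (q * (inverse a - g) + \<mu> * a * g)"
  shows "a * p + k * q \<le> 1 - a * g"
proof -
  let ?D = "q * (inverse a - g) + \<mu> * a * g"
  have D: "0 < ?D"
    using assms by (intro add_pos_nonneg mult_pos_pos mult_nonneg_nonneg) auto
  have "q * g \<le> a * g"
    using q g by (simp add: mult_right_mono)
  also have "\<dots> \<le> \<mu> * (a * g)"
    using mult_right_mono[OF \<mu>, of "a * g"] a g by simp
  finally have "q * inverse a \<le> ?D"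
    by (simp add: algebra_simps)
  then have "k * (q * inverse a) \<le> k * ?D"
    using k by (rule mult_left_mono)
  also have "\<dots> \<le> inverse a - g - p"
    using le D by (simp add: pos_le_divide_eq)
  finally have "a * (k * (q * inverse a)) \<le> a * (inverse a - g - p)"
    using a by (intro mult_left_mono) auto
  moreover have "a * (k * (q * inverse a)) = k * q" "a * inverse a = 1"
    using a by simp_all
  ultimately show ?thesis
    by (simp only: right_diff_distrib)
qed

theorem theorem2:
  fixes f :: "real^'n \<Rightarrow> real^'n"
    and G :: "real^'n \<Rightarrow> real^'m^'n"
    and R :: "real^'m^'n"
    and r :: "real^'n \<Rightarrow> real^'m"
    and H :: "real^'n \<Rightarrow> real^'m^'m"
    and L\<^sub>f L\<^sub>G \<mu> :: real
    and x :: "real^'n"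
    and V :: "(real^'n) set"
  assumes "L\<^sub>f > 0" and "L\<^sub>G > 0"
    and "L\<^sub>f-lipschitz_on UNIV f"
    and "matrix_lipschitz L\<^sub>G G"
    and "factors_through R r H f G"
    and "G 0 \<noteq> 0"
    and "rank (G 0) = CARD('m) \<and> CARD('m) = CARD('n) \<Longrightarrow> \<mu> = 1"
    and "rank (G 0) = min CARD('m) CARD('n) \<and> CARD('m) \<noteq> CARD('n) \<Longrightarrow> \<mu> = sqrt 2"
    and "rank (G 0) < min CARD('m) CARD('n) \<Longrightarrow> \<mu> = (1 + sqrt 5) / 2"
    and "(L\<^sub>f + L\<^sub>G) * norm x \<le> inverse (matrix_norm (pinv (G 0)))"
    and "V = {f 0 + k *\<^sub>R d | k d. norm d = 1 \<and> d \<in> range ((*v) R) \<and>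
                0 \<le> k \<and> k \<le> speed_bound L\<^sub>f L\<^sub>G \<mu> (G 0) x d}"
  shows "V \<subseteq> guaranteed_velocity_set L\<^sub>f L\<^sub>G f G x"
proof -
  let ?A = "G 0" and ?X = "pinv (G 0)"
  let ?a = "matrix_norm ?X" and ?S = "range ((*v) (G 0))"
  let ?g = "L\<^sub>G * norm x" and ?p = "L\<^sub>f * norm x"
  have AXA: "?A ** ?X ** ?A = ?A"
    using moore_penrose_pinv[of ?A] by (simp add: moore_penrose_def)
  have AX: "?A *v (?X *v z) = z" if "z \<in> ?S" for z
    using that AXA by (auto simp: matrix_vector_mul_assoc)
  have "?X \<noteq> 0"
    using AXA assms(6) by auto
  then have a: "0 < ?a"
    by (rule matrix_norm_pos)
  \<comment> \<open>The hypothesis on \<open>x\<close> is not strict; strictness comes from the drift term if \<open>x \<noteq> 0\<close>.\<close>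
  have g: "?g < inverse ?a"
  proof (cases "x = 0")
    case False
    then have "0 < ?p"
      using assms(1) by simp
    with assms(10) show ?thesis
      by (simp add: distrib_right)
  qed (use a in simp)
  then have small: "?a * ?g < 1"
    using a by (simp add: field_simps)
  have "rank ?A \<le> min CARD('m) CARD('n)"
    using rank_bound[of ?A] by (simp add: min.commute)
  then have "\<mu> = 1 \<or> \<mu> = sqrt 2 \<or> \<mu> = (1 + sqrt 5) / 2"
    using assms(7-9) by (metis min.idem nat_less_le)
  moreover have "1 \<le> sqrt 2" "1 \<le> sqrt 5"
    by simp_all
  ultimately have \<mu>: "1 \<le> \<mu>"
    by argo
  have "f 0 + k *\<^sub>R d \<in> {f' x + G' x *v u |u. u \<in> cball 0 1}"
    if d: "norm d = 1" "d \<in> range ((*v) R)"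
      and k: "0 \<le> k" "k \<le> speed_bound L\<^sub>f L\<^sub>G \<mu> ?A x d"
      and con: "(f', G') \<in> consistent_systems L\<^sub>f L\<^sub>G f G" for k d f' G'
  proof -
    obtain R' r' H' where fac: "factors_through R' r' H' f' G'"
      and lip: "L\<^sub>f-lipschitz_on UNIV f'" "matrix_lipschitz L\<^sub>G G'"
      and init: "f' 0 = f 0" "G' 0 = ?A"
      using con unfolding consistent_systems_def by auto
    note ranges = factors_through_ranges[OF fac, unfolded init(2)]
    have dS: "d \<in> ?S"
      using d(2) factors_through_ranges(1)[OF assms(5)] by simp
    let ?y = "(f 0 - f' x) + k *\<^sub>R d"
    have "?y \<in> ?S"
      using ranges(2)[of x] ranges(2)[of 0] dS init(1)
      by (intro subspace_add subspace_diff subspace_scale subspace_range_matrix) auto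
    moreover have "matrix_norm (G' x - ?A) \<le> ?g"
      using lip(2) init(2) unfolding matrix_lipschitz_def by (metis diff_zero)
    ultimately obtain u where u: "G' x *v u = ?y" "(1 - ?a * ?g) * norm u \<le> norm (?X *v ?y)"
      using perturbed_preimage[OF AXA ranges(3)[of x] _ small] by blast
    have "?X *v d \<noteq> 0"
      using AX[OF dS] d(1) by auto
    then have q: "0 < norm (?X *v d)" "norm (?X *v d) \<le> ?a"
      using norm_matrix_vector_le[of ?X d] d(1) by auto
    have "norm (f 0 - f' x) \<le> ?p"
      using lipschitz_onD[OF lip(1), of 0 x] init(1) by (simp add: dist_norm)
    then have "norm (?X *v (f 0 - f' x)) \<le> ?a * ?p"
      using norm_matrix_vector_le[of ?X "f 0 - f' x"] a
      by (meson less_imp_le mult_left_mono order_trans)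
    moreover have "?X *v ?y = ?X *v (f 0 - f' x) + k *\<^sub>R (?X *v d)"
      by (simp add: matrix_vector_right_distrib matrix_vector_mult_scaleR)
    ultimately have "norm (?X *v ?y) \<le> ?a * ?p + k * norm (?X *v d)"
      using norm_triangle_ineq[of "?X *v (f 0 - f' x)" "k *\<^sub>R (?X *v d)"] k(1) by simp
    also have "\<dots> \<le> 1 - ?a * ?g"
      using k(2) assms(2)
      by (intro speed_bound_arith[OF a q _ g \<mu> k(1)]) (simp_all add: speed_bound_def mult.assoc)
    finally have "(1 - ?a * ?g) * norm u \<le> (1 - ?a * ?g) * 1"
      using u(2) by simp
    then have "norm u \<le> 1"
      using small by (simp only: mult_le_cancel_left_pos diff_gt_0_iff_gt)
    moreover have "f 0 + k *\<^sub>R d = f' x + G' x *v u"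
      by (simp add: u(1))
    ultimately show ?thesis
      by auto
  qed
  then show ?thesis
    unfolding assms(11) guaranteed_velocity_set_def by blast
qed

end
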